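(* Let $\mathsf p:\mathbb E\to\mathbb B$ be a restriction functor between restriction categories and let $f:X'\to X$ be an arrow of $\mathbb E$. The following two conditions on $f$ are equivalent: (Original definition of prone) Whenever $g:Y\to X$ in $\mathbb E$ and $h:\mathsf p(Y)\to\mathsf p(X')$ in $\mathbb B$ satisfy $h\,\mathsf p(f)\ge\mathsf p(g)$, there is a map $\widetilde h:Y\to X'$ in $\mathbb E$ such that (a) $\widetilde h$ is a candidate lifting, i.e. $\widetilde h f\ge g$ and $\mathsf p(\widetilde h)\le h$; and (b) $\widetilde h$ is the smallest candidate lifting, i.e. $\widetilde h\le k$ for every $k:Y\to X'$ with $kf\ge g$ and $\mathsf p(k)\le h$. (New definition of prone) Whenever $g:Y\to X$ in $\mathbb E$ and $h:\mathsf p(Y)\to\mathsf p(X')$ in $\mathbb B$ are such that $h\,\mathsf p(f)=\mathsf p(g)$ is a precise triangle with left factor $h$, there is a unique $\widetilde h:Y\to X'$ with $\mathsf p(\widetilde h)=h$ such that $\widetilde h f=g$ is a precise triangle in $\mathbb E$.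
   Context: Composition is written in diagrammatic order. A restriction category is a category with an operation sending each $f:A\to B$ to $\overline f:A\to A$ such that (R.1) $\overline f f=f$; (R.2) $\overline f\,\overline g=\overline g\,\overline f$ for $f,g$ with the same domain; (R.3) $\overline{\overline f g}=\overline f\,\overline g$ for $f,g$ with the same domain; (R.4) $f\overline g=\overline{fg}\,f$ for composable $f,g$. Parallel maps are partially ordered by $f\le g$ iff $\overline f g=f$. A restriction functor is a functor preserving restriction. A commuting triangle $kf=g$ with left factor $k$ is precise if $\overline g=\overline k$. *)

theory Defs
  imports Main
begin

text \<open>Composition is in diagrammatic order throughout: \<open>f \<cdot>\<^bsub>C\<^esub> g\<close> is first \<open>f\<close>, then \<open>g\<close>.
  The operations are only meaningful on the carriers \<open>Ob C\<close> and \<open>Ar C\<close> and, for composition,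
  on composable pairs; all definitions below are relativised accordingly.\<close>

record ('o, 'a) rcat =
  Ob :: "'o set"
  Ar :: "'a set"
  src :: "'a \<Rightarrow> 'o"
  tgt :: "'a \<Rightarrow> 'o"
  ident :: "'o \<Rightarrow> 'a"
  cmp :: "'a \<Rightarrow> 'a \<Rightarrow> 'a"  (infixl "\<cdot>\<index>" 70)
  rst :: "'a \<Rightarrow> 'a"

definition hom :: "('o, 'a, 'c) rcat_scheme \<Rightarrow> 'o \<Rightarrow> 'o \<Rightarrow> 'a set" where
  "hom C A B = {f \<in> Ar C. src C f = A \<and> tgt C f = B}"

locale category =
  fixes C :: "('o, 'a, 'c) rcat_scheme" (structure)
  assumes src_Ob: "f \<in> Ar C \<Longrightarrow> src C f \<in> Ob C"
    and tgt_Ob: "f \<in> Ar C \<Longrightarrow> tgt C f \<in> Ob C"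
    and ident_hom: "A \<in> Ob C \<Longrightarrow> ident C A \<in> hom C A A"
    and cmp_hom: "f \<in> hom C A B \<Longrightarrow> g \<in> hom C B D \<Longrightarrow> f \<cdot> g \<in> hom C A D"
    and ident_cmp: "f \<in> hom C A B \<Longrightarrow> ident C A \<cdot> f = f"
    and cmp_ident: "f \<in> hom C A B \<Longrightarrow> f \<cdot> ident C B = f"
    and cmp_assoc:
      "f \<in> hom C A B \<Longrightarrow> g \<in> hom C B D \<Longrightarrow> h \<in> hom C D E \<Longrightarrow> (f \<cdot> g) \<cdot> h = f \<cdot> (g \<cdot> h)"

locale restriction_category = category C
  for C :: "('o, 'a, 'c) rcat_scheme" (structure) +
  assumes rst_hom: "f \<in> hom C A B \<Longrightarrow> rst C f \<in> hom C A A"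
    and R1: "f \<in> hom C A B \<Longrightarrow> rst C f \<cdot> f = f"
    and R2: "f \<in> hom C A B \<Longrightarrow> g \<in> hom C A D \<Longrightarrow> rst C f \<cdot> rst C g = rst C g \<cdot> rst C f"
    and R3: "f \<in> hom C A B \<Longrightarrow> g \<in> hom C A D \<Longrightarrow> rst C (rst C f \<cdot> g) = rst C f \<cdot> rst C g"
    and R4: "f \<in> hom C A B \<Longrightarrow> g \<in> hom C B D \<Longrightarrow> f \<cdot> rst C g = rst C (f \<cdot> g) \<cdot> f"

text \<open>A functor consists of an object map \<open>pO\<close> and an arrow map \<open>pA\<close>.\<close>

locale restriction_functor =
  E: restriction_category E + B: restriction_category B
  for E :: "('eo, 'ea, 'ec) rcat_scheme"
    and B :: "('bo, 'ba, 'bc) rcat_scheme"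
    and pO :: "'eo \<Rightarrow> 'bo"
    and pA :: "'ea \<Rightarrow> 'ba" +
  assumes map_Ob: "X \<in> Ob E \<Longrightarrow> pO X \<in> Ob B"
    and map_hom: "f \<in> hom E X Y \<Longrightarrow> pA f \<in> hom B (pO X) (pO Y)"
    and map_ident: "X \<in> Ob E \<Longrightarrow> pA (ident E X) = ident B (pO X)"
    and map_cmp: "f \<in> hom E X Y \<Longrightarrow> g \<in> hom E Y Z \<Longrightarrow> pA (f \<cdot>\<^bsub>E\<^esub> g) = pA f \<cdot>\<^bsub>B\<^esub> pA g"
    and map_rst: "f \<in> hom E X Y \<Longrightarrow> pA (rst E f) = rst B (pA f)"

definition rle :: "('o, 'a, 'c) rcat_scheme \<Rightarrow> 'a \<Rightarrow> 'a \<Rightarrow> bool"  (infix "\<sqsubseteq>\<index>" 50) where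
  "f \<sqsubseteq>\<^bsub>C\<^esub> g \<longleftrightarrow>
     f \<in> Ar C \<and> g \<in> Ar C \<and> src C f = src C g \<and> tgt C f = tgt C g \<and> rst C f \<cdot>\<^bsub>C\<^esub> g = f"

text \<open>The triangle \<open>k \<cdot> f = g\<close> commutes and is precise; \<open>k\<close> is its left factor.\<close>

definition precise_triangle :: "('o, 'a, 'c) rcat_scheme \<Rightarrow> 'a \<Rightarrow> 'a \<Rightarrow> 'a \<Rightarrow> bool" where
  "precise_triangle C k f g \<longleftrightarrow>
     k \<in> Ar C \<and> f \<in> Ar C \<and> tgt C k = src C f \<and> k \<cdot>\<^bsub>C\<^esub> f = g \<and> rst C g = rst C k"

definition candidate_lifting ::
  "('eo, 'ea, 'ec) rcat_scheme \<Rightarrow> ('bo, 'ba, 'bc) rcat_scheme \<Rightarrow> ('ea \<Rightarrow> 'ba) \<Rightarrow>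
   'ea \<Rightarrow> 'ea \<Rightarrow> 'ba \<Rightarrow> 'ea \<Rightarrow> bool" where
  "candidate_lifting E B pA f g h k \<longleftrightarrow>
     k \<in> hom E (src E g) (src E f) \<and> g \<sqsubseteq>\<^bsub>E\<^esub> k \<cdot>\<^bsub>E\<^esub> f \<and> pA k \<sqsubseteq>\<^bsub>B\<^esub> h"

definition prone_original ::
  "('eo, 'ea, 'ec) rcat_scheme \<Rightarrow> ('bo, 'ba, 'bc) rcat_scheme \<Rightarrow> ('eo \<Rightarrow> 'bo) \<Rightarrow> ('ea \<Rightarrow> 'ba) \<Rightarrow>
   'eo \<Rightarrow> 'eo \<Rightarrow> 'ea \<Rightarrow> bool" where
  "prone_original E B pO pA X' X f \<longleftrightarrow>
     (\<forall>Y \<in> Ob E. \<forall>g \<in> hom E Y X. \<forall>h \<in> hom B (pO Y) (pO X').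
        pA g \<sqsubseteq>\<^bsub>B\<^esub> h \<cdot>\<^bsub>B\<^esub> pA f \<longrightarrow>
        (\<exists>ht \<in> hom E Y X'.
           candidate_lifting E B pA f g h ht \<and>
           (\<forall>k \<in> hom E Y X'. candidate_lifting E B pA f g h k \<longrightarrow> ht \<sqsubseteq>\<^bsub>E\<^esub> k)))"

definition prone_new ::
  "('eo, 'ea, 'ec) rcat_scheme \<Rightarrow> ('bo, 'ba, 'bc) rcat_scheme \<Rightarrow> ('eo \<Rightarrow> 'bo) \<Rightarrow> ('ea \<Rightarrow> 'ba) \<Rightarrow>
   'eo \<Rightarrow> 'eo \<Rightarrow> 'ea \<Rightarrow> bool" where
  "prone_new E B pO pA X' X f \<longleftrightarrow>
     (\<forall>Y \<in> Ob E. \<forall>g \<in> hom E Y X. \<forall>h \<in> hom B (pO Y) (pO X').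
        precise_triangle B h (pA f) (pA g) \<longrightarrow>
        (\<exists>!ht. ht \<in> hom E Y X' \<and> pA ht = h \<and> precise_triangle E ht f g))"

end

(* Truncating k to the domain of g, i.e. passing to (rst g) k, turns the inequality g \<le> k f into a
   precise triangle. For new \<Longrightarrow> original, truncate h to the domain of pA g, lift it, and compare
   with the truncation of any other candidate via uniqueness. For original \<Longrightarrow> new, the truncation of
   the smallest candidate is again a candidate, so the smallest one is already truncated. *)

theory Submission
  imports Defs
begin

lemma rle_hom_iff:
  assumes "f \<in> hom C A B" "g \<in> hom C A B"
  shows "f \<sqsubseteq>\<^bsub>C\<^esub> g \<longleftrightarrow> rst C f \<cdot>\<^bsub>C\<^esub> g = f"
  using assms by (auto simp: rle_def hom_def)

lemma precise_triangle_hom_iff: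
  assumes "k \<in> hom C A B" "f \<in> hom C B D"
  shows "precise_triangle C k f g \<longleftrightarrow> k \<cdot>\<^bsub>C\<^esub> f = g \<and> rst C g = rst C k"
  using assms by (auto simp: precise_triangle_def hom_def)

lemma candidate_lifting_iff:
  assumes "f \<in> hom E X' X" "g \<in> hom E Y X"
  shows "candidate_lifting E B pA f g h k \<longleftrightarrow>
    k \<in> hom E Y X' \<and> g \<sqsubseteq>\<^bsub>E\<^esub> k \<cdot>\<^bsub>E\<^esub> f \<and> pA k \<sqsubseteq>\<^bsub>B\<^esub> h"
  using assms by (simp add: candidate_lifting_def hom_def)

context restriction_category
begin

lemma rst_cmp_hom:
  assumes g: "g \<in> hom C A D" and k: "k \<in> hom C A B"
  shows "rst C g \<cdot> k \<in> hom C A B"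
  using cmp_hom[OF rst_hom[OF g] k] .

lemma rle_refl: "f \<in> hom C A B \<Longrightarrow> f \<sqsubseteq> f"
  by (simp add: rle_hom_iff R1)

lemma rle_trans:
  assumes f: "f \<in> hom C A B" and g: "g \<in> hom C A B" and h: "h \<in> hom C A B"
    and "f \<sqsubseteq> g" "g \<sqsubseteq> h"
  shows "f \<sqsubseteq> h"
proof -
  have fg: "rst C f \<cdot> g = f" and gh: "rst C g \<cdot> h = g"
    using assms by (simp_all add: rle_hom_iff)
  \<comment> \<open>Smaller maps have smaller restriction idempotents: applying \<open>rst\<close>
    to \<open>fg\<close> and rewriting with (R.3) gives the absorption.\<close>
  have rf: "rst C f \<cdot> rst C g = rst C f"
    using R3[OF f g] fg by simp
  have "rst C f \<cdot> h = rst C f \<cdot> (rst C g \<cdot> h)"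
    using cmp_assoc[OF rst_hom[OF f] rst_hom[OF g] h] rf by simp
  then show ?thesis
    using fg gh f h by (simp add: rle_hom_iff)
qed

lemma rst_cmp_rle:
  assumes g: "g \<in> hom C A D" and k: "k \<in> hom C A B"
  shows "rst C g \<cdot> k \<sqsubseteq> k"
  using R3[OF g k] R1[OF k] cmp_assoc[OF rst_hom[OF g] rst_hom[OF k] k]
  by (simp add: rle_hom_iff[OF rst_cmp_hom[OF g k] k])

text \<open>A composite is defined only where its first factor is. By (R.1) and associativity
  \<open>rst C k\<close> fixes the composite from the left; (R.3) turns this into an absorption of
  idempotents and (R.2) puts them in the stated order.\<close>

lemma rst_cmp_absorb:
  assumes k: "k \<in> hom C A B" and f: "f \<in> hom C B D"
  shows "rst C (k \<cdot> f) \<cdot> rst C k = rst C (k \<cdot> f)"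
proof -
  have "rst C k \<cdot> (k \<cdot> f) = k \<cdot> f"
    using cmp_assoc[OF rst_hom[OF k] k f] R1[OF k] by simp
  then show ?thesis
    using R3[OF k cmp_hom[OF k f]] R2[OF cmp_hom[OF k f] k] by simp
qed

text \<open>The domain of \<open>g\<close> lies in that of the composite, hence in that of
  \<open>k\<close>. So cutting \<open>k\<close> down to \<open>g\<close> leaves a map whose
  restriction is exactly \<open>rst C g\<close>, which is preciseness. This is applied both in the
  base and in the total category.\<close>

lemma
  assumes k: "k \<in> hom C A B" and f: "f \<in> hom C B D" and g: "g \<in> hom C A D"
    and le: "g \<sqsubseteq> k \<cdot> f"
  shows rst_absorb_of_rle_cmp: "rst C g \<cdot> rst C k = rst C g"
    and precise_triangle_truncation: "precise_triangle C (rst C g \<cdot> k) f g"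
proof -
  have kf: "k \<cdot> f \<in> hom C A D"
    using cmp_hom[OF k f] .
  have eq: "rst C g \<cdot> (k \<cdot> f) = g"
    using le g kf by (simp add: rle_hom_iff)
  have rg: "rst C g \<cdot> rst C (k \<cdot> f) = rst C g"
    using R3[OF g kf] eq by simp
  show absorb: "rst C g \<cdot> rst C k = rst C g"
    using cmp_assoc[OF rst_hom[OF g] rst_hom[OF kf] rst_hom[OF k]]
      rst_cmp_absorb[OF k f] rg by simp
  have "rst C (rst C g \<cdot> k) = rst C g"
    using R3[OF g k] absorb by simp
  moreover have "(rst C g \<cdot> k) \<cdot> f = g"
    using cmp_assoc[OF rst_hom[OF g] k f] eq by simp
  ultimately show "precise_triangle C (rst C g \<cdot> k) f g"
    using precise_triangle_hom_iff[OF rst_cmp_hom[OF g k] f] by simp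
qed

end

context restriction_functor
begin

text \<open>Truncations in \<open>E\<close> lie over truncations in \<open>B\<close>, so candidates
  can be compared after applying \<open>pA\<close>.\<close>

lemma map_rst_cmp:
  assumes "g \<in> hom E Y X" "k \<in> hom E Y Z"
  shows "pA (rst E g \<cdot>\<^bsub>E\<^esub> k) = rst B (pA g) \<cdot>\<^bsub>B\<^esub> pA k"
  using map_cmp[OF E.rst_hom[OF assms(1)] assms(2)] map_rst[OF assms(1)] by simp

lemma prone_new_if_prone_original:
  assumes f: "f \<in> hom E X' X" and orig: "prone_original E B pO pA X' X f"
  shows "prone_new E B pO pA X' X f"
  unfolding prone_new_def
proof (intro ballI impI)
  fix Y g h
  assume Y: "Y \<in> Ob E" and g: "g \<in> hom E Y X" and h: "h \<in> hom B (pO Y) (pO X')"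
    and "precise_triangle B h (pA f) (pA g)"
  then have hf: "h \<cdot>\<^bsub>B\<^esub> pA f = pA g" and rh: "rst B (pA g) = rst B h"
    using precise_triangle_hom_iff[OF h map_hom[OF f]] by auto
  note cand = candidate_lifting_iff[OF f g]
  have "pA g \<sqsubseteq>\<^bsub>B\<^esub> h \<cdot>\<^bsub>B\<^esub> pA f"
    using B.rle_refl[OF map_hom[OF g]] hf by simp
  then obtain l where l: "l \<in> hom E Y X'" and cl: "candidate_lifting E B pA f g h l"
    and least: "\<And>k. k \<in> hom E Y X' \<Longrightarrow> candidate_lifting E B pA f g h k \<Longrightarrow> l \<sqsubseteq>\<^bsub>E\<^esub> k"
    using orig Y g h unfolding prone_original_def by blast
  have gl: "g \<sqsubseteq>\<^bsub>E\<^esub> l \<cdot>\<^bsub>E\<^esub> f" and plh: "pA l \<sqsubseteq>\<^bsub>B\<^esub> h"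
    using cl by (simp_all add: cand)
  let ?t = "rst E g \<cdot>\<^bsub>E\<^esub> l"
  have t: "?t \<in> hom E Y X'"
    using E.rst_cmp_hom[OF g l] .
  have t_prec: "?t \<cdot>\<^bsub>E\<^esub> f = g" "rst E ?t = rst E g"
    using E.precise_triangle_truncation[OF l f g gl] precise_triangle_hom_iff[OF t f] by auto
  \<comment> \<open>The truncation lies below \<open>l\<close>, and so does its image; hence it
    stays below \<open>h\<close> and is itself a candidate.\<close>
  have "pA ?t \<sqsubseteq>\<^bsub>B\<^esub> pA l"
    using B.rst_cmp_rle[OF map_hom[OF g] map_hom[OF l]] map_rst_cmp[OF g l] by simp
  then have "pA ?t \<sqsubseteq>\<^bsub>B\<^esub> h"
    using B.rle_trans[OF map_hom[OF t] map_hom[OF l] h] plh by blast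
  then have "l \<sqsubseteq>\<^bsub>E\<^esub> ?t"
    using least[OF t] t E.rle_refl[OF g] t_prec by (simp add: cand)
  \<comment> \<open>The composite of \<open>rst E l\<close> with \<open>?t\<close> is computed
    twice: minimality of \<open>l\<close> makes it \<open>l\<close>, while absorbing
    \<open>rst E l\<close> into \<open>rst E g\<close> makes it \<open>?t\<close>.\<close>
  moreover have "rst E l \<cdot>\<^bsub>E\<^esub> rst E g = rst E g"
    using E.rst_absorb_of_rle_cmp[OF l f g gl] E.R2[OF l g] by simp
  moreover have "(rst E l \<cdot>\<^bsub>E\<^esub> rst E g) \<cdot>\<^bsub>E\<^esub> l = rst E l \<cdot>\<^bsub>E\<^esub> ?t"
    using E.cmp_assoc[OF E.rst_hom[OF l] E.rst_hom[OF g] l] .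
  ultimately have lt: "?t = l"
    using rle_hom_iff[OF l t] t_prec(2) by metis
  have lf: "l \<cdot>\<^bsub>E\<^esub> f = g" and rl: "rst E l = rst E g"
    using t_prec lt by simp_all
  \<comment> \<open>Being a candidate only gives an inequality between \<open>pA l\<close> and
    \<open>h\<close>. Comparable maps with equal restrictions coincide, and both restrictions here
    equal that of \<open>pA g\<close>.\<close>
  have "rst B (pA l) = rst B h"
    using map_rst[OF l] map_rst[OF g] rl rh by simp
  then have plh_eq: "pA l = h"
    using plh B.R1[OF h] rle_hom_iff[OF map_hom[OF l] h] by metis
  show "\<exists>!ht. ht \<in> hom E Y X' \<and> pA ht = h \<and> precise_triangle E ht f g"
  proof (rule ex1I[of _ l])
    show "l \<in> hom E Y X' \<and> pA l = h \<and> precise_triangle E l f g"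
      using l plh_eq lf rl precise_triangle_hom_iff[OF l f] by simp
  next
    fix k
    assume a: "k \<in> hom E Y X' \<and> pA k = h \<and> precise_triangle E k f g"
    then have k: "k \<in> hom E Y X'" and kf: "k \<cdot>\<^bsub>E\<^esub> f = g" and rk: "rst E k = rst E g"
      using precise_triangle_hom_iff[of k E Y X' f X g] f by auto
    \<comment> \<open>Any competing precise lift satisfies the candidate conditions with equalities,
      so it lies above \<open>l\<close>; equal restrictions then force equality.\<close>
    have "candidate_lifting E B pA f g h k"
      using k kf a E.rle_refl[OF g] B.rle_refl[OF h] by (simp add: cand)
    then have "l \<sqsubseteq>\<^bsub>E\<^esub> k"
      using least[OF k] by simp
    then show "k = l"
      using rle_hom_iff[OF l k] E.R1[OF k] rl rk by metis
  qed
qed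

lemma prone_original_if_prone_new:
  assumes f: "f \<in> hom E X' X" and new: "prone_new E B pO pA X' X f"
  shows "prone_original E B pO pA X' X f"
  unfolding prone_original_def
proof (intro ballI impI)
  fix Y g h
  assume Y: "Y \<in> Ob E" and g: "g \<in> hom E Y X" and h: "h \<in> hom B (pO Y) (pO X')"
    and le: "pA g \<sqsubseteq>\<^bsub>B\<^esub> h \<cdot>\<^bsub>B\<^esub> pA f"
  note cand = candidate_lifting_iff[OF f g]
  note pg = map_hom[OF g]
  \<comment> \<open>The given \<open>h\<close> may be defined on more than the domain of
    \<open>pA g\<close>, so the new condition need not apply to it; it does apply to this
    truncation.\<close>
  let ?h = "rst B (pA g) \<cdot>\<^bsub>B\<^esub> h"
  have h': "?h \<in> hom B (pO Y) (pO X')"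
    using B.rst_cmp_hom[OF pg h] .
  have "precise_triangle B ?h (pA f) (pA g)"
    using B.precise_triangle_truncation[OF h map_hom[OF f] pg le] .
  then have ex1: "\<exists>!ht. ht \<in> hom E Y X' \<and> pA ht = ?h \<and> precise_triangle E ht f g"
    using new Y g h' unfolding prone_new_def by blast
  then obtain l where l: "l \<in> hom E Y X'" and pl: "pA l = ?h"
    and tri: "precise_triangle E l f g"
    by blast
  have lf: "l \<cdot>\<^bsub>E\<^esub> f = g" and rl: "rst E l = rst E g"
    using tri precise_triangle_hom_iff[OF l f] by auto
  have cl: "candidate_lifting E B pA f g h l"
    using l lf pl E.rle_refl[OF g] B.rst_cmp_rle[OF pg h] by (simp add: cand)
  have "l \<sqsubseteq>\<^bsub>E\<^esub> k" if k: "k \<in> hom E Y X'" and ck: "candidate_lifting E B pA f g h k" for k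
  proof -
    have gk: "g \<sqsubseteq>\<^bsub>E\<^esub> k \<cdot>\<^bsub>E\<^esub> f" and pkh: "rst B (pA k) \<cdot>\<^bsub>B\<^esub> h = pA k"
      using ck rle_hom_iff[OF map_hom[OF k] h] by (auto simp: cand)
    let ?k = "rst E g \<cdot>\<^bsub>E\<^esub> k"
    note pk = map_hom[OF k]
    \<comment> \<open>Although \<open>pA k\<close> may be strictly below \<open>h\<close>, it agrees
      with \<open>h\<close> on its own domain, which contains that of \<open>pA g\<close>. Hence
      truncating either one to \<open>pA g\<close> gives \<open>?h\<close>.\<close>
    have "rst B (pA g) \<cdot>\<^bsub>B\<^esub> rst B (pA k) = rst B (pA g)"
      using map_rst_cmp[OF g E.rst_hom[OF k]] E.rst_absorb_of_rle_cmp[OF k f g gk]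
        map_rst[OF k] map_rst[OF g] by simp
    then have "pA ?k = ?h"
      using map_rst_cmp[OF g k] pkh B.cmp_assoc[OF B.rst_hom[OF pg] B.rst_hom[OF pk] h]
      by simp
    \<comment> \<open>Every candidate has the same truncation, by uniqueness of the precise lift of
      \<open>?h\<close>; thus \<open>l\<close> is a truncation of \<open>k\<close> and lies below
      it.\<close>
    then have "?k = l"
      using ex1 l pl tri E.rst_cmp_hom[OF g k] E.precise_triangle_truncation[OF k f g gk]
      by blast
    then show ?thesis
      using E.rst_cmp_rle[OF g k] by simp
  qed
  then show "\<exists>ht \<in> hom E Y X'. candidate_lifting E B pA f g h ht \<and>
      (\<forall>k \<in> hom E Y X'. candidate_lifting E B pA f g h k \<longrightarrow> ht \<sqsubseteq>\<^bsub>E\<^esub> k)"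
    using l cl by blast
qed

end

theorem propositionA3:
  fixes E :: "('eo, 'ea, 'ec) rcat_scheme"
    and B :: "('bo, 'ba, 'bc) rcat_scheme"
    and pO :: "'eo \<Rightarrow> 'bo"
    and pA :: "'ea \<Rightarrow> 'ba"
  assumes "restriction_functor E B pO pA"
    and "X' \<in> Ob E" and "X \<in> Ob E"
    and "f \<in> hom E X' X"
  shows "prone_original E B pO pA X' X f \<longleftrightarrow> prone_new E B pO pA X' X f"
  using restriction_functor.prone_new_if_prone_original[OF assms(1,4)]
    restriction_functor.prone_original_if_prone_new[OF assms(1,4)] by blast

end
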